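(* Let $r\geq k\geq 1$, $t\in\{2,3\}$, and let $\varphi$ be a $t$-critical $(r,k)$-colouring of $K_n$. If $t=2$ then $n\leq r$, and if $t=3$ then $n\leq r+\binom{r}{2}$. Moreover, if in $\varphi$ every vertex sees each colour of $[r]$, then $t=3$ and $n\leq\binom{r}{2}$.
   Context: For integers $r\geq k\geq 1$, an $(r,k)$-colouring of a graph $G$ is a function $\varphi:E(G)\to\binom{[r]}{k}$, assigning to each edge a set of exactly $k$ colours from $[r]=\{1,\dots,r\}$. A monochromatic component in colour $i$ is a connected component of the spanning subgraph of $G$ consisting of all edges $e$ with $i\in\varphi(e)$. $\mathrm{tc}(G,\varphi)$ is the minimum number of monochromatic components (equivalently, monochromatic trees; a single vertex counts) whose union covers $V(G)$. A vertex sees colour $i$ if it is incident to an edge $e$ with $i\in\varphi(e)$. The colouring $\varphi$ is $t$-critical if $\mathrm{tc}(G,\varphi)=t$ and for each vertex $v\in V(G)$, the set $V(G)\setminus\{v\}$ can be covered by $t-1$ monochromatic components of $(G,\varphi)$. *)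

theory Defs
  imports "HOL-Library.Ramsey"
begin

text \<open>
  A graph is given by a vertex set \<open>V\<close> and a set \<open>E\<close> of two-element subsets of \<open>V\<close>;
  the complete graph on \<open>V\<close> has edge set \<open>[V]\<^bsup>2\<^esup>\<close>. Only the values of
  \<open>\<phi>\<close> on \<open>E\<close> matter.
\<close>

definition rk_colouring :: "nat \<Rightarrow> nat \<Rightarrow> 'a set set \<Rightarrow> ('a set \<Rightarrow> nat set) \<Rightarrow> bool" where
  "rk_colouring r k E \<phi> \<longleftrightarrow> (\<forall>e\<in>E. \<phi> e \<in> [{1..r}]\<^bsup>k\<^esup>)"

definition colour_adj :: "'a set set \<Rightarrow> ('a set \<Rightarrow> nat set) \<Rightarrow> nat \<Rightarrow> ('a \<times> 'a) set" where
  "colour_adj E \<phi> i = {(x, y). {x, y} \<in> E \<and> i \<in> \<phi> {x, y}}"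

text \<open>
  Components are identified with their vertex sets. They are components of the spanning
  subgraph in colour \<open>i\<close>, so a vertex not seeing colour \<open>i\<close> forms a
  single-vertex component in that colour.
\<close>

definition mono_components ::
    "'a set \<Rightarrow> 'a set set \<Rightarrow> ('a set \<Rightarrow> nat set) \<Rightarrow> nat \<Rightarrow> 'a set set" where
  "mono_components V E \<phi> i = {{w \<in> V. (v, w) \<in> (colour_adj E \<phi> i)\<^sup>*} |v. v \<in> V}"

definition coverable ::
    "nat \<Rightarrow> 'a set \<Rightarrow> 'a set set \<Rightarrow> ('a set \<Rightarrow> nat set) \<Rightarrow> 'a set \<Rightarrow> nat \<Rightarrow> bool" where
  "coverable r V E \<phi> W m \<longleftrightarrow>
     (\<exists>\<C>. \<C> \<subseteq> (\<Union>i\<in>{1..r}. mono_components V E \<phi> i) \<and> finite \<C> \<and> card \<C> = m \<and> W \<subseteq> \<Union>\<C>)"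

definition tc :: "nat \<Rightarrow> 'a set \<Rightarrow> 'a set set \<Rightarrow> ('a set \<Rightarrow> nat set) \<Rightarrow> nat" where
  "tc r V E \<phi> = (LEAST m. coverable r V E \<phi> V m)"

text \<open>
  In a critical colouring, \<open>V - {v}\<close> is covered by components of the whole
  coloured graph; these may contain \<open>v\<close>.
\<close>

definition critical ::
    "nat \<Rightarrow> nat \<Rightarrow> 'a set \<Rightarrow> 'a set set \<Rightarrow> ('a set \<Rightarrow> nat set) \<Rightarrow> bool" where
  "critical t r V E \<phi> \<longleftrightarrow>
     tc r V E \<phi> = t \<and> (\<forall>v\<in>V. coverable r V E \<phi> (V - {v}) (t - 1))"

definition sees :: "'a set set \<Rightarrow> ('a set \<Rightarrow> nat set) \<Rightarrow> 'a \<Rightarrow> nat \<Rightarrow> bool" where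
  "sees E \<phi> v i \<longleftrightarrow> (\<exists>e\<in>E. v \<in> e \<and> i \<in> \<phi> e)"

end

theory Submission
  imports Defs "HOL-Library.Disjoint_Sets"
begin

text \<open>
  Each colour partitions \<open>V\<close> into components, and any two vertices share a component in some
  colour. Assign to every vertex \<open>v\<close> the set of colours of \<open>t - 1\<close> components covering
  \<open>V - {v}\<close>, a single colour whenever possible; this assignment is injective.
  Indeed, let \<open>t = 3\<close> and suppose that \<open>v \<noteq> w\<close> both receive \<open>{i, j}\<close>.
  Since a component containing both \<open>v\<close> and \<open>w\<close> and one further component
  never cover \<open>V\<close>, the \<open>i\<close>-components used for \<open>v\<close> and \<open>w\<close> are disjoint, and so are the
  \<open>j\<close>-components. Since they do not cover \<open>V\<close> either, they must be \<open>X \<union> {w}\<close> and \<open>Y\<close>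
  in one colour, \<open>Y\<close> and \<open>X \<union> {v}\<close> in the other; but then the first colour alone covers
  \<open>V - {v}\<close>. If two components of one colour cover \<open>V - {v}\<close> but not \<open>v\<close>, then \<open>v\<close>
  does not see that colour.
\<close>

section \<open>Partitions of one set in which every pair of points shares a part\<close>

locale linked_partitions =
  fixes V :: "'a set" and I :: "'b set" and P :: "'b \<Rightarrow> 'a set set"
  assumes partition: "i \<in> I \<Longrightarrow> partition_on V (P i)"
    and linked: "v \<in> V \<Longrightarrow> w \<in> V \<Longrightarrow> v \<noteq> w \<Longrightarrow> \<exists>i\<in>I. \<exists>A\<in>P i. v \<in> A \<and> w \<in> A"
begin

lemma part_subset: "i \<in> I \<Longrightarrow> A \<in> P i \<Longrightarrow> A \<subseteq> V"
  using partition by (auto simp: partition_on_def)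

lemma ex_part: "i \<in> I \<Longrightarrow> v \<in> V \<Longrightarrow> \<exists>A\<in>P i. v \<in> A"
  using partition partition_onD1 by (metis UnionE)

lemma part_eq: "i \<in> I \<Longrightarrow> A \<in> P i \<Longrightarrow> B \<in> P i \<Longrightarrow> x \<in> A \<Longrightarrow> x \<in> B \<Longrightarrow> A = B"
  using partition partition_onD2 disjointD by (metis disjoint_iff)

text \<open>Give each \<open>v\<close> an index with a part equal to \<open>V - {v}\<close>. If
  \<open>v\<close> and \<open>w\<close> shared an index, their parts would be distinct, hence
  disjoint, leaving \<open>V = {v, w}\<close>; a part linking \<open>v\<close> and \<open>w\<close>
  would then cover \<open>V\<close>.\<close>

lemma card_le_if_one_part_missing:
  assumes "finite I"
    and no_cover: "\<And>i A. i \<in> I \<Longrightarrow> A \<in> P i \<Longrightarrow> \<not> V \<subseteq> A"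
    and miss: "\<And>v. v \<in> V \<Longrightarrow> \<exists>i\<in>I. \<exists>A\<in>P i. V - {v} \<subseteq> A"
  shows "card V \<le> card I"
proof -
  obtain c where c: "\<And>v. v \<in> V \<Longrightarrow> c v \<in> I \<and> (\<exists>A\<in>P (c v). V - {v} \<subseteq> A)"
    using miss by metis
  have "inj_on c V"
  proof (rule inj_onI, rule ccontr)
    fix v w assume vw: "v \<in> V" "w \<in> V" "c v = c w" "v \<noteq> w"
    obtain A B where A: "A \<in> P (c v)" "V - {v} \<subseteq> A" and B: "B \<in> P (c v)" "V - {w} \<subseteq> B"
      using c vw by metis
    have "v \<notin> A" using A no_cover c vw by blast
    then have "A \<noteq> B" using B vw by blast
    then have "V \<subseteq> {v, w}" using part_eq A B c vw by blast
    then show False using linked[OF vw(1,2,4)] no_cover by blast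
  qed
  then show ?thesis using c \<open>finite I\<close> by (intro card_inj_on_le[of c]) auto
qed

text \<open>Equality instead of inclusion records that both parts avoid \<open>v\<close>. The case
  \<open>i = j\<close>, even \<open>A = B\<close>, is allowed.\<close>

definition covers_but :: "'a \<Rightarrow> 'b \<Rightarrow> 'b \<Rightarrow> bool" where
  "covers_but v i j \<longleftrightarrow> i \<in> I \<and> j \<in> I \<and> (\<exists>A\<in>P i. \<exists>B\<in>P j. A \<union> B = V - {v})"

lemma covers_but_commute: "covers_but v i j \<Longrightarrow> covers_but v j i"
  unfolding covers_but_def by blast

lemma covers_but_singleton:
  assumes "covers_but v i i" "A \<in> P i" "v \<in> A"
  shows "A = {v}"
proof -
  obtain B C where BC: "i \<in> I" "B \<in> P i" "C \<in> P i" "B \<union> C = V - {v}"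
    using assms(1) unfolding covers_but_def by blast
  have "v \<notin> B" "v \<notin> C" using BC(4) by auto
  moreover have "A = B \<or> A \<inter> B = {}" "A = C \<or> A \<inter> C = {}"
    using part_eq[OF BC(1) assms(2) BC(2)] part_eq[OF BC(1) assms(2) BC(3)] by blast+
  ultimately have "A \<inter> (B \<union> C) = {}" using assms(3) by auto
  then show ?thesis using part_subset[OF BC(1) assms(2)] assms(3) unfolding BC(4) by blast
qed

context
  assumes no_cover: "\<And>i j A B. i \<in> I \<Longrightarrow> j \<in> I \<Longrightarrow> A \<in> P i \<Longrightarrow> B \<in> P j \<Longrightarrow> \<not> V \<subseteq> A \<union> B"
begin

text \<open>A part linking \<open>v\<close> and \<open>w\<close> would complete \<open>A\<close> to
  a cover of \<open>V\<close> by two parts.\<close>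

lemma no_cover_but_two:
  assumes "v \<in> V" "w \<in> V" "v \<noteq> w" "i \<in> I" "A \<in> P i"
  shows "\<not> V - {v, w} \<subseteq> A"
proof
  assume "V - {v, w} \<subseteq> A"
  moreover obtain j B where "j \<in> I" "B \<in> P j" "v \<in> B" "w \<in> B" using linked assms by blast
  ultimately show False using no_cover[of i j A B] assms by blast
qed

text \<open>One of the two parts covering \<open>V - {v}\<close> contains \<open>w\<close>, so it is
  \<open>{w}\<close> by \<open>covers_but_singleton\<close>. The other one then contains all of
  \<open>V - {v, w}\<close>.\<close>

lemma covers_but_inj:
  assumes v: "v \<in> V" "covers_but v i i" and w: "w \<in> V" "covers_but w i i"
  shows "v = w"
proof (rule ccontr)
  assume "v \<noteq> w"
  obtain A B where AB: "i \<in> I" "A \<in> P i" "B \<in> P i" "A \<union> B = V - {v}"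
    using v unfolding covers_but_def by blast
  then have "A = {w} \<or> B = {w}"
    using covers_but_singleton[OF w(2)] w \<open>v \<noteq> w\<close> by blast
  then show False using no_cover_but_two[OF v(1) w(1) \<open>v \<noteq> w\<close>] AB by blast
qed

lemma covers_but_same_colours:
  assumes v: "v \<in> V" "covers_but v i j" and w: "w \<in> V" "covers_but w i j" and "v \<noteq> w"
  shows "covers_but v i i \<or> covers_but v j j"
proof -
  obtain A B where AB: "i \<in> I" "j \<in> I" "A \<in> P i" "B \<in> P j" "A \<union> B = V - {v}"
    using v unfolding covers_but_def by blast
  obtain A' B' where AB': "A' \<in> P i" "B' \<in> P j" "A' \<union> B' = V - {w}"
    using w unfolding covers_but_def by blast
  note no_two = no_cover_but_two[OF v(1) w(1) \<open>v \<noteq> w\<close>]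
  have disj: "A = A' \<or> A \<inter> A' = {}" "B = B' \<or> B \<inter> B' = {}"
    using part_eq[OF \<open>i \<in> I\<close> AB(3) AB'(1)] part_eq[OF \<open>j \<in> I\<close> AB(4) AB'(2)] by blast+
  have vw: "w \<in> A \<union> B" "v \<in> A' \<union> B'" "v \<notin> A \<union> B" "w \<notin> A' \<union> B'"
    using AB(5) AB'(3) v(1) w(1) \<open>v \<noteq> w\<close> by auto
  have rest: "V - {v, w} \<subseteq> A \<union> B" "V - {v, w} \<subseteq> A' \<union> B'" using AB(5) AB'(3) by auto
  \<comment> \<open>If \<open>A = A'\<close>, this part avoids both \<open>v\<close> and
    \<open>w\<close>, so \<open>w \<in> B\<close> and \<open>v \<in> B'\<close>. Thus
    \<open>B\<close> and \<open>B'\<close> are disjoint, and \<open>A\<close> alone has to cover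
    \<open>V - {v, w}\<close>.\<close>
  have A: "A \<inter> A' = {}" using disj rest vw no_two[OF AB(1,3)] by blast
  have B: "B \<inter> B' = {}" using disj rest vw no_two[OF AB(2,4)] by blast
  have "\<not> V \<subseteq> A \<union> A'" "\<not> V \<subseteq> B \<union> B'"
    using no_cover[OF AB(1,1,3) AB'(1)] no_cover[OF AB(2,2,4) AB'(2)] by auto
  moreover have "V - {v, w} \<subseteq> A \<union> A'" "V - {v, w} \<subseteq> B \<union> B'" using A B rest by blast+
  moreover have "A \<union> A' \<subseteq> V" "B \<union> B' \<subseteq> V" using AB(5) AB'(3) by auto
  \<comment> \<open>Neither union contains both \<open>v\<close> and \<open>w\<close>, but each of
    these points lies in one of the unions. So one union contains \<open>w\<close> and misses
    \<open>v\<close>.\<close>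
  ultimately have "A \<union> A' = V - {v} \<or> B \<union> B' = V - {v}" using vw by blast
  then show ?thesis using AB AB' unfolding covers_but_def by blast
qed

lemma inj_on_colour_sets:
  assumes miss: "\<And>v. v \<in> V \<Longrightarrow> \<exists>i j. covers_but v i j"
  obtains f where "inj_on f V"
    and "\<And>v. v \<in> V \<Longrightarrow> f v \<in> [I]\<^bsup>1\<^esup> \<union> [I]\<^bsup>2\<^esup>"
    and "\<And>v. v \<in> V \<Longrightarrow> \<not> (\<exists>i. covers_but v i i) \<Longrightarrow> f v \<in> [I]\<^bsup>2\<^esup>"
proof -
  \<comment> \<open>Preferring a single index is what makes \<open>f\<close> injective: a shared
    pair of distinct indices would yield a single index for \<open>v\<close>.\<close>
  have "\<exists>i j. covers_but v i j \<and> ((\<exists>l. covers_but v l l) \<longrightarrow> i = j)" if "v \<in> V" for v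
    using miss[OF that] by blast
  then obtain c d where "\<And>v. v \<in> V \<Longrightarrow>
      covers_but v (c v) (d v) \<and> ((\<exists>l. covers_but v l l) \<longrightarrow> c v = d v)"
    by metis
  then have cd: "covers_but v (c v) (d v)" "\<And>l. covers_but v l l \<Longrightarrow> c v = d v" if "v \<in> V" for v
    using that by blast+
  define f where "f v = {c v, d v}" for v
  show thesis
  proof
    show "inj_on f V"
    proof (rule inj_onI, rule ccontr)
      fix v w assume vw: "v \<in> V" "w \<in> V" "f v = f w" "v \<noteq> w"
      then have w: "covers_but w (c v) (d v)"
        using cd(1)[of w] covers_but_commute by (fastforce simp: f_def doubleton_eq_iff)
      then have eq: "c v = d v"
        using covers_but_same_colours cd vw by metis
      then show False using covers_but_inj cd(1)[of v] w vw by metis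
    qed
  next
    fix v assume v: "v \<in> V"
    have I: "c v \<in> I" "d v \<in> I" using cd(1)[OF v] by (auto simp: covers_but_def)
    then show "f v \<in> [I]\<^bsup>1\<^esup> \<union> [I]\<^bsup>2\<^esup>"
      by (cases "c v = d v") (auto simp: f_def nsets_def)
    assume "\<not> (\<exists>i. covers_but v i i)"
    then have "c v \<noteq> d v" using cd(1)[OF v] by metis
    then show "f v \<in> [I]\<^bsup>2\<^esup>" using I by (auto simp: f_def nsets_def)
  qed
qed

lemma card_le_if_two_parts_missing:
  assumes "finite I" and miss: "\<And>v. v \<in> V \<Longrightarrow> \<exists>i j. covers_but v i j"
  shows "card V \<le> card I + (card I choose 2)"
proof -
  obtain f where "inj_on f V" "\<And>v. v \<in> V \<Longrightarrow> f v \<in> [I]\<^bsup>1\<^esup> \<union> [I]\<^bsup>2\<^esup>"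
    using inj_on_colour_sets[OF miss] by metis
  then have "card V \<le> card ([I]\<^bsup>1\<^esup> \<union> [I]\<^bsup>2\<^esup>)"
    using \<open>finite I\<close> by (intro card_inj_on_le[of f]) (auto intro: finite_imp_finite_nsets)
  also have "\<dots> \<le> card ([I]\<^bsup>1\<^esup>) + card ([I]\<^bsup>2\<^esup>)" by (rule card_Un_le)
  finally show ?thesis by simp
qed

text \<open>By \<open>covers_but_singleton\<close> a single index never suffices, so the injection
  takes only two-element sets as values.\<close>

lemma card_le_if_no_singletons:
  assumes "finite I" and miss: "\<And>v. v \<in> V \<Longrightarrow> \<exists>i j. covers_but v i j"
    and big: "\<And>v i. v \<in> V \<Longrightarrow> i \<in> I \<Longrightarrow> {v} \<notin> P i"
  shows "card V \<le> card I choose 2"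
proof -
  have "\<not> covers_but v i i" if "v \<in> V" for v i
  proof
    assume c: "covers_but v i i"
    then have "i \<in> I" by (simp add: covers_but_def)
    then obtain A where "A \<in> P i" "v \<in> A" using ex_part \<open>v \<in> V\<close> by metis
    then show False using covers_but_singleton[OF c] big that \<open>i \<in> I\<close> by metis
  qed
  then obtain f where "inj_on f V" "\<And>v. v \<in> V \<Longrightarrow> f v \<in> [I]\<^bsup>2\<^esup>"
    using inj_on_colour_sets[OF miss] by metis
  then have "card V \<le> card ([I]\<^bsup>2\<^esup>)"
    using \<open>finite I\<close> by (intro card_inj_on_le[of f]) (auto intro: finite_imp_finite_nsets)
  then show ?thesis by simp
qed

end

end

section \<open>Monochromatic components as linked partitions\<close>

lemma sym_colour_adj: "sym (colour_adj E \<phi> i)"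
  by (auto simp: sym_def colour_adj_def insert_commute)

lemma mono_components_eq_quotient:
  "mono_components V E \<phi> i = V // ((colour_adj E \<phi> i)\<^sup>* \<inter> V \<times> V)"
  by (auto simp: mono_components_def quotient_def)

lemma partition_on_mono_components: "partition_on V (mono_components V E \<phi> i)"
  unfolding mono_components_eq_quotient
proof (rule partition_on_quotient, rule equivI)
  show "sym ((colour_adj E \<phi> i)\<^sup>* \<inter> V \<times> V)"
    using sym_rtrancl[OF sym_colour_adj] by (metis sym_Int sym_def SigmaE2 SigmaI mem_Sigma_iff)
  show "trans ((colour_adj E \<phi> i)\<^sup>* \<inter> V \<times> V)"
    by (auto simp: trans_def)
qed (auto simp: refl_on_def)

lemma mono_component_edge:
  assumes "{v, w} \<in> E" "i \<in> \<phi> {v, w}" "v \<in> V" "w \<in> V"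
  shows "\<exists>A\<in>mono_components V E \<phi> i. v \<in> A \<and> w \<in> A"
  using assms by (auto simp: mono_components_def colour_adj_def intro!: bexI[of _ v])

lemma sees_not_singleton:
  assumes "sees ([V]\<^bsup>2\<^esup>) \<phi> v i"
  shows "{v} \<notin> mono_components V ([V]\<^bsup>2\<^esup>) \<phi> i"
proof
  assume v: "{v} \<in> mono_components V ([V]\<^bsup>2\<^esup>) \<phi> i"
  obtain e where e: "e \<in> [V]\<^bsup>2\<^esup>" "v \<in> e" "i \<in> \<phi> e" using assms by (auto simp: sees_def)
  then obtain w where w: "e = {v, w}" "w \<noteq> v" by (auto simp: nsets_def card_2_iff)
  then have "v \<in> V" "w \<in> V" using e by (auto simp: nsets_def)
  then obtain A where A: "A \<in> mono_components V ([V]\<^bsup>2\<^esup>) \<phi> i" "v \<in> A" "w \<in> A"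
    using mono_component_edge e w by metis
  then have "A = {v}"
    using v partition_onD2[OF partition_on_mono_components] disjointD by (metis disjoint_iff singletonI)
  then show False using A w by blast
qed

lemma linked_partitions_mono_components:
  assumes "1 \<le> k" "rk_colouring r k ([V]\<^bsup>2\<^esup>) \<phi>"
  shows "linked_partitions V {1..r} (mono_components V ([V]\<^bsup>2\<^esup>) \<phi>)"
proof
  show "partition_on V (mono_components V ([V]\<^bsup>2\<^esup>) \<phi> i)" for i
    by (rule partition_on_mono_components)
  fix v w assume vw: "v \<in> V" "w \<in> V" "v \<noteq> w"
  then have e: "{v, w} \<in> [V]\<^bsup>2\<^esup>" by (auto simp: nsets_def)
  then have "\<phi> {v, w} \<in> [{1..r}]\<^bsup>k\<^esup>" using assms(2) by (simp add: rk_colouring_def)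
  then have "\<phi> {v, w} \<subseteq> {1..r}" "\<phi> {v, w} \<noteq> {}"
    using \<open>1 \<le> k\<close> by (auto simp: nsets_def)
  then obtain i where "i \<in> {1..r}" "i \<in> \<phi> {v, w}" by blast
  then show "\<exists>i\<in>{1..r}. \<exists>A\<in>mono_components V ([V]\<^bsup>2\<^esup>) \<phi> i. v \<in> A \<and> w \<in> A"
    using mono_component_edge e vw by metis
qed

section \<open>Covers by at most two components\<close>

lemma coverableI:
  assumes "i \<in> {1..r}" "j \<in> {1..r}" "A \<in> mono_components V E \<phi> i" "B \<in> mono_components V E \<phi> j"
    and "W \<subseteq> A \<union> B"
  shows "coverable r V E \<phi> W (card {A, B})"
  unfolding coverable_def using assms by (intro exI[of _ "{A, B}"]) auto

lemma tc_le_two: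
  assumes "i \<in> {1..r}" "j \<in> {1..r}" "A \<in> mono_components V E \<phi> i" "B \<in> mono_components V E \<phi> j"
    and "V \<subseteq> A \<union> B"
  shows "tc r V E \<phi> \<le> 2"
proof -
  have "tc r V E \<phi> \<le> card {A, B}"
    unfolding tc_def by (rule Least_le, rule coverableI[OF assms])
  \<comment> \<open>\<open>A\<close> and \<open>B\<close> may coincide, while
    \<open>coverable\<close> fixes the exact number of components; hence the detour through
    \<open>card {A, B}\<close>.\<close>
  also have "\<dots> \<le> 2" by (simp add: card_insert_if)
  finally show ?thesis .
qed

lemma tc_le_one:
  assumes "i \<in> {1..r}" "A \<in> mono_components V E \<phi> i" "V \<subseteq> A"
  shows "tc r V E \<phi> \<le> 1"
proof -
  have "coverable r V E \<phi> V 1" using coverableI[OF assms(1,1,2,2)] assms(3) by simp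
  then show ?thesis unfolding tc_def by (rule Least_le)
qed

lemma tc_empty: "tc r {} E \<phi> = 0"
  unfolding tc_def by (rule Least_eq_0) (auto simp: coverable_def)

theorem theorem5p2:
  fixes r k t n :: nat and V :: "'a set" and \<phi> :: "'a set \<Rightarrow> nat set"
  assumes "1 \<le> k" and "k \<le> r" and "t \<in> {2, 3}"
    and "finite V" and "card V = n"
    and "rk_colouring r k ([V]\<^bsup>2\<^esup>) \<phi>"
    and "critical t r V ([V]\<^bsup>2\<^esup>) \<phi>"
  shows "(t = 2 \<longrightarrow> n \<le> r) \<and>
         (t = 3 \<longrightarrow> n \<le> r + (r choose 2)) \<and>
         ((\<forall>v\<in>V. \<forall>i\<in>{1..r}. sees ([V]\<^bsup>2\<^esup>) \<phi> v i) \<longrightarrow> t = 3 \<and> n \<le> (r choose 2))"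
proof -
  let ?P = "mono_components V ([V]\<^bsup>2\<^esup>) \<phi>"
  interpret linked_partitions V "{1..r}" ?P
    by (rule linked_partitions_mono_components[OF assms(1,6)])
  have tc: "tc r V ([V]\<^bsup>2\<^esup>) \<phi> = t"
    and cov: "\<And>v. v \<in> V \<Longrightarrow> coverable r V ([V]\<^bsup>2\<^esup>) \<phi> (V - {v}) (t - 1)"
    using assms(7) unfolding critical_def by blast+
  show ?thesis
  proof (cases "t = 2")
    case True
    have no_cover: "\<not> V \<subseteq> A" if "i \<in> {1..r}" "A \<in> ?P i" for i A
      using tc_le_one[OF that] tc True by auto
    have miss: "\<exists>i\<in>{1..r}. \<exists>A\<in>?P i. V - {v} \<subseteq> A" if "v \<in> V" for v
    proof -
      obtain \<C> where C: "\<C> \<subseteq> (\<Union>i\<in>{1..r}. ?P i)" "card \<C> = 1" "V - {v} \<subseteq> \<Union>\<C>"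
        using cov[OF \<open>v \<in> V\<close>] True unfolding coverable_def by auto
      then obtain A where "\<C> = {A}" using card_1_singletonE by metis
      then show ?thesis using C by auto
    qed
    have "\<not> (\<forall>v\<in>V. \<forall>i\<in>{1..r}. sees ([V]\<^bsup>2\<^esup>) \<phi> v i)"
    proof -
      \<comment> \<open>On an empty \<open>V\<close> the claim that every vertex sees each colour
        would hold vacuously.\<close>
      have "V \<noteq> {}" using tc True tc_empty by (metis zero_neq_numeral)
      then obtain v where v: "v \<in> V" by blast
      then obtain i A where A: "i \<in> {1..r}" "A \<in> ?P i" "V - {v} \<subseteq> A" using miss by blast
      obtain B where B: "B \<in> ?P i" "v \<in> B" using ex_part A(1) v by metis
      \<comment> \<open>The component \<open>B\<close> of \<open>v\<close> is disjoint from
        \<open>A\<close>, which contains everything else. So \<open>v\<close> is isolated in colour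
        \<open>i\<close> and does not see it.\<close>
      have "A \<noteq> B" using no_cover A B by blast
      then have "B = {v}" using A B part_eq part_subset by blast
      then show ?thesis using sees_not_singleton A B v by metis
    qed
    then show ?thesis
      using True card_le_if_one_part_missing no_cover miss assms(5) by auto
  next
    case False
    then have t: "t = 3" using assms(3) by simp
    have no_cover: "\<not> V \<subseteq> A \<union> B"
      if "i \<in> {1..r}" "j \<in> {1..r}" "A \<in> ?P i" "B \<in> ?P j" for i j A B
      using tc_le_two[OF that] tc t by auto
    have miss: "\<exists>i j. covers_but v i j" if "v \<in> V" for v
    proof -
      obtain \<C> where C: "\<C> \<subseteq> (\<Union>i\<in>{1..r}. ?P i)" "card \<C> = 2" "V - {v} \<subseteq> \<Union>\<C>"
        using cov[OF \<open>v \<in> V\<close>] t unfolding coverable_def by auto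
      then obtain A B where "\<C> = {A, B}" by (metis card_2_iff)
      then obtain i j where ij: "i \<in> {1..r}" "j \<in> {1..r}" "A \<in> ?P i" "B \<in> ?P j" "V - {v} \<subseteq> A \<union> B"
        using C by auto
      \<comment> \<open>The two components cannot contain \<open>v\<close> as well, since they would
        then cover \<open>V\<close>.\<close>
      then have "A \<union> B = V - {v}"
        using no_cover[OF ij(1-4)] part_subset[OF ij(1,3)] part_subset[OF ij(2,4)] by blast
      then show ?thesis using ij unfolding covers_but_def by blast
    qed
    have "card V \<le> card {1..r} + (card {1..r} choose 2)"
      by (rule card_le_if_two_parts_missing)
        (assumption | rule no_cover finite_atLeastAtMost miss)+
    moreover have "card V \<le> card {1..r} choose 2"
      if sees: "\<forall>v\<in>V. \<forall>i\<in>{1..r}. sees ([V]\<^bsup>2\<^esup>) \<phi> v i"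
      by (rule card_le_if_no_singletons)
        (assumption | rule no_cover finite_atLeastAtMost miss sees_not_singleton sees[rule_format])+
    ultimately show ?thesis using t assms(5) by simp
  qed
qed

end
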